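(* Let $f, g_1,\ldots,g_m$ be convex polynomials on $\mathbb{R}^n$ with $K := \{x\in\mathbb{R}^n \mid g_1(x)\le 0,\ldots,g_m(x)\le 0\}\neq\emptyset$, and consider the problem $f^* := \min_{x\in K} f(x)$. Let $L:\mathbb{R}^n\times\mathbb{R}^m_+\to\mathbb{R}$ be the Lagrangian function defined by $L(x,\lambda):=f(x)+\sum_{i=1}^m\lambda_i g_i(x)$. Let $c\in\mathbb{R}$ be such that $c>f(x^0)$ for some $x^0\in K$, and for each integer $k$ let $f_k^* := \sup\{\mu\in\mathbb{R} \mid f-\mu\in\mathbf{M}_k\}$, where $\mathbf{M}_k$ is the truncated quadratic module generated by $c-f,-g_1,\ldots,-g_m$. If the Lasserre hierarchy $(f_k^* )_k$ has finite convergence, then for every minimizer $x^*$ of $f$ over $K$ there exists $\lambda^*\in\mathbb{R}^m_+$ such that $(x^*,\lambda^* )$ is a saddle-point of $L$.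
   Context: $\mathbb{R}[\underline{x}]$ is the ring of real polynomials in $x=(x_1,\ldots,x_n)$, and $\mathbb{R}^m_+$ is the non-negative orthant. $\Sigma^2\subset\mathbb{R}[\underline{x}]$ is the set of sum-of-squares polynomials (finite sums of squares of polynomials in $\mathbb{R}[\underline{x}]$). For each integer $k$, $$\mathbf{M}_k := \Big\{\sigma_0-\sum_{i=1}^m\sigma_i g_i+\sigma(c-f) \ \Big|\ \sigma,\sigma_0,\sigma_1,\ldots,\sigma_m\in\Sigma^2,\ \deg\sigma_0\le 2k,\ \deg(\sigma_i g_i)\le 2k\ (i=1,\ldots,m),\ \deg(\sigma(c-f))\le 2k\Big\}.$$ The supremum of the empty set is $-\infty$, and the zero polynomial satisfies every degree bound. The hierarchy has finite convergence if there is an integer $k$ such that $f_k^*=f^*$ and the supremum defining $f_k^*$ is attained. A pair $(x^*,\lambda^* )$ with $\lambda^*\in\mathbb{R}^m_+$ is a saddle-point of $L$ if $L(x,\lambda^* )\ge L(x^*,\lambda^* )\ge L(x^*,\lambda)$ for all $x\in\mathbb{R}^n$ and all $\lambda\in\mathbb{R}^m_+$. *)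

theory Defs
  imports "HOL-Analysis.Analysis" "HOL-Library.Poly_Mapping" "HOL-Library.FuncSet"
begin

text \<open>
  Real polynomials in the variables \<open>x $ j\<close>, \<open>j :: 'n\<close>: finitely supported maps from exponent
  vectors to coefficients. The ring structure is the convolution product of
  \<^theory>\<open>HOL-Library.Poly_Mapping\<close>.
\<close>

type_synonym 'n rpoly = "('n \<Rightarrow>\<^sub>0 nat) \<Rightarrow>\<^sub>0 real"

definition rpoly_const :: "real \<Rightarrow> 'n rpoly" where
  "rpoly_const a = Poly_Mapping.single 0 a"

definition rpoly_eval :: "('n::finite) rpoly \<Rightarrow> real ^ 'n \<Rightarrow> real" where
  "rpoly_eval p x =
     (\<Sum>t\<in>Poly_Mapping.keys p.
        Poly_Mapping.lookup p t * (\<Prod>j\<in>UNIV. (x $ j) ^ Poly_Mapping.lookup t j))"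

text \<open>Total degree; the value at the zero polynomial is a dummy, see \<open>deg_le\<close>.\<close>

definition total_degree :: "('n::finite) rpoly \<Rightarrow> nat" where
  "total_degree p =
     (if p = 0 then 0
      else Max ((\<lambda>t. \<Sum>j\<in>UNIV. Poly_Mapping.lookup t j) ` Poly_Mapping.keys p))"

text \<open>The zero polynomial satisfies every degree bound, also a negative one.\<close>

definition deg_le :: "('n::finite) rpoly \<Rightarrow> int \<Rightarrow> bool" where
  "deg_le p d \<longleftrightarrow> p = 0 \<or> int (total_degree p) \<le> d"

definition SOS :: "'n rpoly set" where
  "SOS = {p. \<exists>(r::nat) (q :: nat \<Rightarrow> 'n rpoly). p = (\<Sum>j<r. (q j)\<^sup>2)}"

definition feasible_set :: "nat \<Rightarrow> (nat \<Rightarrow> ('n::finite) rpoly) \<Rightarrow> (real ^ 'n) set" where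
  "feasible_set m g = {x. \<forall>i\<in>{1..m}. rpoly_eval (g i) x \<le> 0}"

text \<open>\<open>f\<^sup>*\<close>, in the extended reals so that it is meaningful without attainment.\<close>

definition opt_value :: "nat \<Rightarrow> ('n::finite) rpoly \<Rightarrow> (nat \<Rightarrow> 'n rpoly) \<Rightarrow> ereal" where
  "opt_value m f g = (INF x\<in>feasible_set m g. ereal (rpoly_eval f x))"

definition is_minimizer ::
  "nat \<Rightarrow> ('n::finite) rpoly \<Rightarrow> (nat \<Rightarrow> 'n rpoly) \<Rightarrow> real ^ 'n \<Rightarrow> bool" where
  "is_minimizer m f g x \<longleftrightarrow>
     x \<in> feasible_set m g \<and> (\<forall>y\<in>feasible_set m g. rpoly_eval f x \<le> rpoly_eval f y)"

definition trunc_module ::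
  "nat \<Rightarrow> ('n::finite) rpoly \<Rightarrow> (nat \<Rightarrow> 'n rpoly) \<Rightarrow> real \<Rightarrow> int \<Rightarrow> 'n rpoly set" where
  "trunc_module m f g c k =
     {s0 - (\<Sum>i=1..m. s i * g i) + t * (rpoly_const c - f) | s0 s t.
        t \<in> SOS \<and> s0 \<in> SOS \<and> (\<forall>i\<in>{1..m}. s i \<in> SOS) \<and>
        deg_le s0 (2 * k) \<and> (\<forall>i\<in>{1..m}. deg_le (s i * g i) (2 * k)) \<and>
        deg_le (t * (rpoly_const c - f)) (2 * k)}"

definition relax_feasible ::
  "nat \<Rightarrow> ('n::finite) rpoly \<Rightarrow> (nat \<Rightarrow> 'n rpoly) \<Rightarrow> real \<Rightarrow> int \<Rightarrow> real set" where
  "relax_feasible m f g c k = {\<mu>. f - rpoly_const \<mu> \<in> trunc_module m f g c k}"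

text \<open>\<open>f\<^sub>k\<^sup>*\<close>; in \<open>ereal\<close> the supremum of the empty set is \<open>-\<infinity>\<close>.\<close>

definition relax_value ::
  "nat \<Rightarrow> ('n::finite) rpoly \<Rightarrow> (nat \<Rightarrow> 'n rpoly) \<Rightarrow> real \<Rightarrow> int \<Rightarrow> ereal" where
  "relax_value m f g c k = (SUP \<mu>\<in>relax_feasible m f g c k. ereal \<mu>)"

definition finite_convergence ::
  "nat \<Rightarrow> ('n::finite) rpoly \<Rightarrow> (nat \<Rightarrow> 'n rpoly) \<Rightarrow> real \<Rightarrow> bool" where
  "finite_convergence m f g c \<longleftrightarrow>
     (\<exists>k. relax_value m f g c k = opt_value m f g \<and>
          (\<exists>\<mu>\<in>relax_feasible m f g c k. ereal \<mu> = relax_value m f g c k))"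

text \<open>
  The orthant \<open>\<real>\<^sup>m\<^sub>+\<close> as extensional functions on \<open>{1..m}\<close>, so that \<open>m\<close> is an arbitrary natural
  number (\<open>m = 0\<close> included).
\<close>

definition nonneg_orthant :: "nat \<Rightarrow> (nat \<Rightarrow> real) set" where
  "nonneg_orthant m = {1..m} \<rightarrow>\<^sub>E {0..}"

definition Lagrangian ::
  "nat \<Rightarrow> ('n::finite) rpoly \<Rightarrow> (nat \<Rightarrow> 'n rpoly) \<Rightarrow> real ^ 'n \<Rightarrow> (nat \<Rightarrow> real) \<Rightarrow> real" where
  "Lagrangian m f g x l = rpoly_eval f x + (\<Sum>i=1..m. l i * rpoly_eval (g i) x)"

definition saddle_point ::
  "nat \<Rightarrow> (real ^ ('n::finite) \<Rightarrow> (nat \<Rightarrow> real) \<Rightarrow> real) \<Rightarrow> real ^ 'n \<Rightarrow> (nat \<Rightarrow> real) \<Rightarrow> bool" where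
  "saddle_point m L xs ls \<longleftrightarrow>
     ls \<in> nonneg_orthant m \<and>
     (\<forall>x. L x ls \<ge> L xs ls) \<and> (\<forall>l\<in>nonneg_orthant m. L xs ls \<ge> L xs l)"

end

theory Submission
  imports Defs
begin

text \<open>
  A certificate \<open>f - \<mu> = \<sigma>\<^sub>0 - (\<Sum>i. \<sigma>\<^sub>i g\<^sub>i) + \<sigma> (c - f)\<close> with \<open>\<mu> = f\<^sup>*\<close> yields Lagrange multipliers without
  any constraint qualification. Evaluated at a minimizer \<open>x\<^sup>*\<close>, the left-hand side vanishes, whereas
  every summand on the right is nonnegative; hence \<open>\<sigma>\<^sub>0(x\<^sup>*) = 0\<close>, \<open>\<sigma>\<^sub>i(x\<^sup>*) g\<^sub>i(x\<^sup>*) = 0\<close> and, since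
  \<open>c > f(x\<^sup>*)\<close>, also \<open>\<sigma>(x\<^sup>*) = 0\<close>. Put \<open>\<lambda>\<^sub>i = \<sigma>\<^sub>i(x\<^sup>*)\<close>, so that complementary slackness holds.

  A zero of a sum of squares is a global minimum, so all its directional derivatives vanish there.
  Rewriting the certificate as
  \<open>f + (\<Sum>i. \<lambda>\<^sub>i g\<^sub>i) - \<mu> = \<sigma>\<^sub>0 + (\<Sum>i. (\<lambda>\<^sub>i - \<sigma>\<^sub>i) g\<^sub>i) + \<sigma> (c - f)\<close> and differentiating along a line
  through \<open>x\<^sup>*\<close>, each summand on the right has derivative zero at \<open>x\<^sup>*\<close>: \<open>\<sigma>\<^sub>0\<close> and \<open>\<sigma>\<close> vanish and are stationary there,
  and for each \<open>i\<close> either \<open>g\<^sub>i(x\<^sup>*) = 0\<close>, or \<open>\<sigma>\<^sub>i(x\<^sup>*) = 0\<close> and \<open>\<sigma>\<^sub>i\<close> is stationary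
  (\<open>certificate_stationary\<close>). Thus \<open>x\<^sup>*\<close> is a stationary point of
  the convex function \<open>L(\<cdot>, \<lambda>\<^sup>*)\<close>, hence a global minimizer of it
  (\<open>convex_stationary_along_segment\<close>). The other saddle-point inequality is feasibility of \<open>x\<^sup>*\<close>
  together with complementary slackness.
\<close>

section \<open>Evaluation of polynomials\<close>

lemma rpoly_eval_0 [simp]: "rpoly_eval 0 x = 0"
  by (simp add: rpoly_eval_def)

lemma rpoly_eval_single:
  "rpoly_eval (Poly_Mapping.single t a) x = a * (\<Prod>j\<in>UNIV. (x $ j) ^ Poly_Mapping.lookup t j)"
  by (cases "a = 0") (simp_all add: rpoly_eval_def)

lemma rpoly_eval_const [simp]: "rpoly_eval (rpoly_const a) x = a"
  by (simp add: rpoly_const_def rpoly_eval_single)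

lemma rpoly_eval_add [simp]: "rpoly_eval (p + q) x = rpoly_eval p x + rpoly_eval q x"
  unfolding rpoly_eval_def
  by (rule setsum_keys_plus_distrib) (simp_all add: distrib_right)

lemma rpoly_eval_minus [simp]: "rpoly_eval (- p) x = - rpoly_eval p x"
  using rpoly_eval_add [of p "- p" x] by simp

lemma rpoly_eval_diff [simp]: "rpoly_eval (p - q) x = rpoly_eval p x - rpoly_eval q x"
  using rpoly_eval_add [of p "- q" x] by simp

lemma rpoly_eval_sum [simp]: "rpoly_eval (\<Sum>i\<in>I. p i) x = (\<Sum>i\<in>I. rpoly_eval (p i) x)"
  by (induction I rule: infinite_finite_induct) simp_all

lemma rpoly_induct [case_names zero add_monomial]:
  fixes p :: "'n rpoly"
  assumes "P 0"
    and "\<And>q t a. P q \<Longrightarrow> P (q + Poly_Mapping.single t a)"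
  shows "P p"
proof (induction p rule: Poly_Mapping.update_induct)
  case const
  then show ?case by (rule assms(1))
next
  case (update q t a)
  have "Poly_Mapping.update t a q = q + Poly_Mapping.single t a"
    using \<open>t \<notin> Poly_Mapping.keys q\<close>
    by (intro poly_mapping_eqI)
       (auto simp: Poly_Mapping.lookup_update lookup_add lookup_single when_def in_keys_iff)
  with update.IH show ?case by (simp add: assms(2))
qed

lemma rpoly_eval_mult [simp]: "rpoly_eval (p * q) x = rpoly_eval p x * rpoly_eval q x"
proof (induction p rule: rpoly_induct)
  case zero
  then show ?case by simp
next
  case (add_monomial p t a)
  have "rpoly_eval (Poly_Mapping.single t a * q) x
      = rpoly_eval (Poly_Mapping.single t a) x * rpoly_eval q x"
  proof (induction q rule: rpoly_induct)
    case zero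
    then show ?case by simp
  next
    case (add_monomial q u b)
    then show ?case
      by (simp add: distrib_left mult_single rpoly_eval_single lookup_add power_add prod.distrib)
  qed
  with add_monomial show ?case by (simp add: distrib_right)
qed

lemma SOS_eval_nonneg: "s \<in> SOS \<Longrightarrow> 0 \<le> rpoly_eval s x"
  by (auto simp: SOS_def power2_eq_square intro!: sum_nonneg)

lemma rpoly_eval_has_directional_derivative:
  fixes p :: "('n::finite) rpoly"
  obtains D where "((\<lambda>r. rpoly_eval p (x + r *\<^sub>R v)) has_real_derivative D) (at 0)"
proof -
  have component: "real_polynomial_function (\<lambda>r::real. (x + r *\<^sub>R v) $ j)" for j
    unfolding vector_add_component vector_scaleR_component real_scaleR_def
    by (intro real_polynomial_function.intros bounded_linear_mult_left)
  have "real_polynomial_function (\<lambda>r. rpoly_eval p (x + r *\<^sub>R v))"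
    unfolding rpoly_eval_def
    by (intro real_polynomial_function_sum real_polynomial_function.intros(2,4)
        real_polynomial_function_prod
        real_polynomial_function_power component) simp_all
  then show thesis
    using has_real_derivative_polynomial_function that by blast
qed

section \<open>Stationarity\<close>

lemma SOS_stationary_at_zero:
  assumes "s \<in> SOS" and "rpoly_eval s x = 0"
  shows "((\<lambda>r. rpoly_eval s (x + r *\<^sub>R v)) has_real_derivative 0) (at 0)"
proof -
  obtain D where D: "((\<lambda>r. rpoly_eval s (x + r *\<^sub>R v)) has_real_derivative D) (at 0)"
    by (rule rpoly_eval_has_directional_derivative)
  have "D = 0"
    using SOS_eval_nonneg [OF assms(1)] assms(2)
    by (intro DERIV_local_min [OF D, of 1]) simp_all
  with D show ?thesis by simp
qed

lemma convex_stationary_along_segment: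
  fixes h :: "'a::real_vector \<Rightarrow> real"
  assumes "convex_on UNIV h"
    and "((\<lambda>r. h (a + r *\<^sub>R (b - a))) has_real_derivative 0) (at 0)"
  shows "h a \<le> h b"
proof -
  have "convex_on UNIV (\<lambda>r. h (a + r *\<^sub>R (b - a)))"
  proof (rule convex_onI)
    fix t y z :: real
    assume t: "0 < t" "t < 1"
    have "a + ((1 - t) *\<^sub>R y + t *\<^sub>R z) *\<^sub>R (b - a)
        = (1 - t) *\<^sub>R (a + y *\<^sub>R (b - a)) + t *\<^sub>R (a + z *\<^sub>R (b - a))"
      by (simp add: algebra_simps)
    with t show "h (a + ((1 - t) *\<^sub>R y + t *\<^sub>R z) *\<^sub>R (b - a))
        \<le> (1 - t) * h (a + y *\<^sub>R (b - a)) + t * h (a + z *\<^sub>R (b - a))"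
      using convex_onD [OF assms(1), of t "a + y *\<^sub>R (b - a)" "a + z *\<^sub>R (b - a)"] by simp
  qed simp
  from convex_on_imp_above_tangent [OF this, of 0 1 0] assms(2)
  show ?thesis by simp
qed

lemma convex_on_Lagrangian:
  assumes "convex_on UNIV (rpoly_eval f)"
    and "\<And>i. i \<in> {1..m} \<Longrightarrow> convex_on UNIV (rpoly_eval (g i))"
    and "\<And>i. i \<in> {1..m} \<Longrightarrow> 0 \<le> l i"
  shows "convex_on UNIV (\<lambda>x. Lagrangian m f g x l)"
proof -
  have "convex_on UNIV (\<lambda>x. \<Sum>i\<in>I. l i * rpoly_eval (g i) x)" if "I \<subseteq> {1..m}" for I
    using finite_subset [OF that finite_atLeastAtMost] that
  proof (induction I rule: finite_induct)
    case empty
    then show ?case by (simp add: convex_on_const)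
  next
    case (insert i I)
    then show ?case using assms(2,3) by (auto intro!: convex_on_add convex_on_cmul)
  qed
  then show ?thesis
    unfolding Lagrangian_def using assms(1) by (intro convex_on_add) simp_all
qed

text \<open>
  The values of the multipliers of a certificate at a feasible point attaining the certified bound
  are Karush-Kuhn-Tucker multipliers: complementary slackness holds and the Lagrangian has vanishing
  derivative in each direction.
\<close>

lemma certificate_stationary:
  fixes f :: "('n::finite) rpoly"
  assumes cert: "f - rpoly_const \<mu> = s0 - (\<Sum>i=1..m. s i * g i) + t * (rpoly_const c - f)"
    and SOS: "s0 \<in> SOS" "t \<in> SOS" "\<And>i. i \<in> {1..m} \<Longrightarrow> s i \<in> SOS"
    and xs: "xs \<in> feasible_set m g" "rpoly_eval f xs = \<mu>" "\<mu> < c"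
    and l: "\<And>i. i \<in> {1..m} \<Longrightarrow> l i = rpoly_eval (s i) xs"
  shows "\<And>i. i \<in> {1..m} \<Longrightarrow> l i * rpoly_eval (g i) xs = 0"
    and "((\<lambda>r. Lagrangian m f g (xs + r *\<^sub>R v) l) has_real_derivative 0) (at 0)"
proof -
  have eval: "rpoly_eval f x - \<mu> = rpoly_eval s0 x
      + (\<Sum>i=1..m. - (rpoly_eval (s i) x * rpoly_eval (g i) x))
      + rpoly_eval t x * (c - rpoly_eval f x)" for x
    using arg_cong [OF cert, of "\<lambda>p. rpoly_eval p x"] by (simp add: sum_negf)
  have s0_ge: "0 \<le> rpoly_eval s0 xs" using SOS(1) by (rule SOS_eval_nonneg)
  have sg_ge: "0 \<le> - (rpoly_eval (s i) xs * rpoly_eval (g i) xs)" if "i \<in> {1..m}" for i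
    using SOS_eval_nonneg [OF SOS(3) [OF that], of xs] xs(1) that
    by (simp add: feasible_set_def mult_nonneg_nonpos)
  have t_ge: "0 \<le> rpoly_eval t xs * (c - rpoly_eval f xs)"
    using SOS_eval_nonneg [OF SOS(2), of xs] xs by simp
  have sum_ge: "0 \<le> (\<Sum>i=1..m. - (rpoly_eval (s i) xs * rpoly_eval (g i) xs))"
    by (intro sum_nonneg sg_ge)
  have s0: "rpoly_eval s0 xs = 0"
    and sum0: "(\<Sum>i=1..m. - (rpoly_eval (s i) xs * rpoly_eval (g i) xs)) = 0"
    and t0: "rpoly_eval t xs * (c - rpoly_eval f xs) = 0"
    using eval [of xs] xs(2) s0_ge t_ge sum_ge by linarith+
  have t: "rpoly_eval t xs = 0"
    using t0 xs(2,3) by simp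
  have sg: "rpoly_eval (s i) xs * rpoly_eval (g i) xs = 0" if "i \<in> {1..m}" for i
  proof -
    from sum0 sg_ge have "\<forall>i\<in>{1..m}. - (rpoly_eval (s i) xs * rpoly_eval (g i) xs) = 0"
      by (subst (asm) sum_nonneg_eq_0_iff) auto
    with that show ?thesis by auto
  qed
  show "l i * rpoly_eval (g i) xs = 0" if "i \<in> {1..m}" for i
    using sg [OF that] l [OF that] by simp

  have Lagr: "Lagrangian m f g x l = \<mu> + rpoly_eval s0 x
      + (\<Sum>i=1..m. (l i - rpoly_eval (s i) x) * rpoly_eval (g i) x)
      + rpoly_eval t x * (c - rpoly_eval f x)" for x
    using eval [of x] by (simp add: Lagrangian_def left_diff_distrib sum_subtractf sum_negf)
  have term_deriv: "((\<lambda>r. (l i - rpoly_eval (s i) (xs + r *\<^sub>R v)) * rpoly_eval (g i) (xs + r *\<^sub>R v))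
      has_real_derivative 0) (at 0)" if i: "i \<in> {1..m}" for i
  proof -
    obtain Ds where Ds: "((\<lambda>r. rpoly_eval (s i) (xs + r *\<^sub>R v)) has_real_derivative Ds) (at 0)"
      by (rule rpoly_eval_has_directional_derivative)
    obtain Dg where Dg: "((\<lambda>r. rpoly_eval (g i) (xs + r *\<^sub>R v)) has_real_derivative Dg) (at 0)"
      by (rule rpoly_eval_has_directional_derivative)
    have "Ds * rpoly_eval (g i) xs = 0"
    proof (cases "rpoly_eval (g i) xs = 0")
      case False
      then have "rpoly_eval (s i) xs = 0" using sg [OF i] by simp
      then have "Ds = 0"
        using DERIV_unique [OF Ds] SOS_stationary_at_zero [OF SOS(3) [OF i]] by blast
      then show ?thesis by simp
    qed simp
    then show ?thesis
      using l [OF i] by (auto intro!: derivative_eq_intros Ds Dg)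
  qed
  obtain Df where Df: "((\<lambda>r. rpoly_eval f (xs + r *\<^sub>R v)) has_real_derivative Df) (at 0)"
    by (rule rpoly_eval_has_directional_derivative)
  have sum_deriv: "((\<lambda>r. \<Sum>i=1..m. (l i - rpoly_eval (s i) (xs + r *\<^sub>R v))
      * rpoly_eval (g i) (xs + r *\<^sub>R v)) has_real_derivative 0) (at 0)"
    using DERIV_sum [of "{1..m}", OF term_deriv] by simp
  have slack_deriv: "((\<lambda>r. rpoly_eval t (xs + r *\<^sub>R v) * (c - rpoly_eval f (xs + r *\<^sub>R v)))
      has_real_derivative 0) (at 0)"
    using t by (auto intro!: derivative_eq_intros Df SOS_stationary_at_zero [OF SOS(2) t])
  show "((\<lambda>r. Lagrangian m f g (xs + r *\<^sub>R v) l) has_real_derivative 0) (at 0)"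
    unfolding Lagr
    using DERIV_add [OF DERIV_add [OF DERIV_add [OF DERIV_const
        SOS_stationary_at_zero [OF SOS(1) s0]] sum_deriv] slack_deriv] by simp
qed

section \<open>Saddle points from finite convergence\<close>

lemma opt_value_minimizer:
  assumes "is_minimizer m f g xs"
  shows "opt_value m f g = ereal (rpoly_eval f xs)"
  unfolding opt_value_def
proof (rule antisym)
  show "(INF x\<in>feasible_set m g. ereal (rpoly_eval f x)) \<le> ereal (rpoly_eval f xs)"
    using assms by (intro INF_lower) (simp add: is_minimizer_def)
  show "ereal (rpoly_eval f xs) \<le> (INF x\<in>feasible_set m g. ereal (rpoly_eval f x))"
    using assms by (intro INF_greatest) (simp add: is_minimizer_def)
qed

theorem theorem3p4:
  fixes m :: nat
    and f :: "('n::finite) rpoly"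
    and g :: "nat \<Rightarrow> 'n rpoly"
    and c :: real
  assumes f_convex: "convex_on UNIV (rpoly_eval f)"
    and g_convex: "\<And>i. i \<in> {1..m} \<Longrightarrow> convex_on UNIV (rpoly_eval (g i))"
    and K_nonempty: "feasible_set m g \<noteq> {}"
    and c_gt: "\<exists>x0\<in>feasible_set m g. c > rpoly_eval f x0"
    and conv: "finite_convergence m f g c"
  shows "\<forall>xs. is_minimizer m f g xs \<longrightarrow>
           (\<exists>ls\<in>nonneg_orthant m. saddle_point m (Lagrangian m f g) xs ls)"
proof (intro allI impI)
  fix xs
  assume min: "is_minimizer m f g xs"
  then have feas: "xs \<in> feasible_set m g" by (simp add: is_minimizer_def)
  define \<mu> where "\<mu> = rpoly_eval f xs"
  obtain k where "\<mu> \<in> relax_feasible m f g c k"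
    using conv opt_value_minimizer [OF min]
    by (auto simp: finite_convergence_def \<mu>_def)
  then obtain s0 s t where
    cert: "f - rpoly_const \<mu> = s0 - (\<Sum>i=1..m. s i * g i) + t * (rpoly_const c - f)"
    and SOS: "s0 \<in> SOS" "t \<in> SOS" "\<And>i. i \<in> {1..m} \<Longrightarrow> s i \<in> SOS"
    by (auto simp: relax_feasible_def trunc_module_def)
  have "\<mu> < c"
    using c_gt min unfolding is_minimizer_def \<mu>_def by force
  define ls where "ls = restrict (\<lambda>i. rpoly_eval (s i) xs) {1..m}"
  have l: "ls i = rpoly_eval (s i) xs" if "i \<in> {1..m}" for i
    using that by (simp add: ls_def)
  have orthant: "ls \<in> nonneg_orthant m"
    using SOS(3) by (auto simp: nonneg_orthant_def ls_def SOS_eval_nonneg)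
  note kkt = certificate_stationary [OF cert SOS feas \<mu>_def [symmetric] \<open>\<mu> < c\<close> l]
  have "Lagrangian m f g xs ls \<le> Lagrangian m f g x ls" for x
  proof (rule convex_stationary_along_segment [where h = "\<lambda>x. Lagrangian m f g x ls"])
    show "convex_on UNIV (\<lambda>x. Lagrangian m f g x ls)"
      using f_convex g_convex SOS(3) l by (intro convex_on_Lagrangian) (auto simp: SOS_eval_nonneg)
  qed (rule kkt(2))
  moreover have "Lagrangian m f g xs l' \<le> Lagrangian m f g xs ls" if "l' \<in> nonneg_orthant m" for l'
  proof -
    have "(\<Sum>i=1..m. l' i * rpoly_eval (g i) xs) \<le> 0"
      using that feas
      by (intro sum_nonpos mult_nonneg_nonpos) (auto simp: nonneg_orthant_def feasible_set_def)
    also have "0 = (\<Sum>i=1..m. ls i * rpoly_eval (g i) xs)"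
      using kkt(1) by (intro sum.neutral [symmetric]) blast
    finally show ?thesis by (simp add: Lagrangian_def)
  qed
  ultimately show "\<exists>ls\<in>nonneg_orthant m. saddle_point m (Lagrangian m f g) xs ls"
    using orthant by (auto simp: saddle_point_def)
qed

end
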